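(* Let $X$ be a complex Banach space and let $L\in GL(X)$. The following properties are equivalent: (1) $L$ is expansive and has the shadowing property. (2) $L$ is asymptotically expansive and has the shadowing property. (3) $L$ is hyperbolic.
   Context: $GL(X)$ is the set of linear homeomorphisms $L:X\to X$ (bounded, invertible, with bounded inverse). $L$ is expansive if there is $\epsilon>0$ such that if $x,y\in X$ and $\|L^n(x)-L^n(y)\|\leq\epsilon$ for all $n\in\mathbb{Z}$, then $x=y$. $L$ is asymptotically expansive if there is $\epsilon>0$ such that, for $x\in X$, if $\|L^n(x)\|\leq\epsilon$ for all $n\geq0$, then $\lim_{n\to\infty}L^n(x)=0$. $L$ has the shadowing property if for every $\epsilon>0$ there is $\delta>0$ such that for every sequence $(x_n)_{n\in\mathbb{Z}}$ in $X$ with $\|L(x_n)-x_{n+1}\|\leq\delta$ for all $n\in\mathbb{Z}$ there is $x\in X$ such that $\|L^n(x)-x_n\|\leq\epsilon$ for all $n\in\mathbb{Z}$. $L$ is hyperbolic if its spectrum does not meet the unit circle; equivalently, there is a direct sum $X=S\oplus U$ by closed subspaces $S,U$ with $L(S)=S$, $L(U)=U$, $r(L|_S)<1$ and $r(L^{-1}|_U)<1$, where $r$ denotes the spectral radius. *)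

theory Defs
  imports "HOL-Analysis.Analysis"
begin

text \<open>The libraries provide only real normed spaces. A complex Banach space is a real one
  with a compatible complex scalar multiplication under which the norm is absolutely homogeneous.\<close>

class scaleC =
  fixes scaleC :: "complex \<Rightarrow> 'a \<Rightarrow> 'a" (infixr "*\<^sub>C" 75)

class complex_normed_vector = real_normed_vector + scaleC +
  assumes scaleC_add_right: "a *\<^sub>C (x + y) = a *\<^sub>C x + a *\<^sub>C y"
    and scaleC_add_left: "(a + b) *\<^sub>C x = a *\<^sub>C x + b *\<^sub>C x"
    and scaleC_scaleC: "a *\<^sub>C b *\<^sub>C x = (a * b) *\<^sub>C x"
    and scaleC_one: "1 *\<^sub>C x = x"
    and scaleR_scaleC: "scaleR r x = complex_of_real r *\<^sub>C x"
    and norm_scaleC: "norm (a *\<^sub>C x) = cmod a * norm x"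

class complex_banach = complex_normed_vector + banach

instantiation complex :: complex_banach
begin

definition scaleC_complex :: "complex \<Rightarrow> complex \<Rightarrow> complex"
  where "scaleC_complex a x = a * x"

instance
  by standard
    (simp_all add: scaleC_complex_def algebra_simps norm_mult scaleR_conv_of_real)

end

definition bounded_clinear :: "('a::complex_normed_vector \<Rightarrow> 'b::complex_normed_vector) \<Rightarrow> bool"
  where "bounded_clinear f \<longleftrightarrow> bounded_linear f \<and> (\<forall>c x. f (c *\<^sub>C x) = c *\<^sub>C f x)"

definition GL :: "('a::complex_normed_vector \<Rightarrow> 'a) set"
  where "GL = {L. bounded_clinear L \<and> bij L \<and> bounded_clinear (inv L)}"

definition spectrum :: "('a::complex_normed_vector \<Rightarrow> 'a) \<Rightarrow> complex set"
  where "spectrum L = {c. (\<lambda>x. L x - c *\<^sub>C x) \<notin> GL}"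

text \<open>Integer iterates of a bijection.\<close>

definition iterate :: "('a \<Rightarrow> 'a) \<Rightarrow> int \<Rightarrow> 'a \<Rightarrow> 'a"
  where "iterate L n = (if n \<ge> 0 then L ^^ nat n else inv L ^^ nat (- n))"

definition expansive :: "('a::complex_normed_vector \<Rightarrow> 'a) \<Rightarrow> bool"
  where "expansive L \<longleftrightarrow>
    (\<exists>\<epsilon>>0. \<forall>x y. (\<forall>n. norm (iterate L n x - iterate L n y) \<le> \<epsilon>) \<longrightarrow> x = y)"

definition asymptotically_expansive :: "('a::complex_normed_vector \<Rightarrow> 'a) \<Rightarrow> bool"
  where "asymptotically_expansive L \<longleftrightarrow>
    (\<exists>\<epsilon>>0. \<forall>x. (\<forall>n. norm ((L ^^ n) x) \<le> \<epsilon>) \<longrightarrow> (\<lambda>n. (L ^^ n) x) \<longlonglongrightarrow> 0)"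

definition shadowing :: "('a::complex_normed_vector \<Rightarrow> 'a) \<Rightarrow> bool"
  where "shadowing L \<longleftrightarrow>
    (\<forall>\<epsilon>>0. \<exists>\<delta>>0. \<forall>\<xi> :: int \<Rightarrow> 'a.
      (\<forall>n. norm (L (\<xi> n) - \<xi> (n + 1)) \<le> \<delta>) \<longrightarrow>
      (\<exists>x. \<forall>n. norm (iterate L n x - \<xi> n) \<le> \<epsilon>))"

definition hyperbolic :: "('a::complex_normed_vector \<Rightarrow> 'a) \<Rightarrow> bool"
  where "hyperbolic L \<longleftrightarrow> spectrum L \<inter> sphere 0 1 = {}"

end

theory Submission
  imports Defs
begin

text \<open>
  Everything is read off from the inhomogeneous equation \<open>y (n + 1) = L (y n) + e n\<close> over the
  integers. Shadowing says exactly that every bounded \<open>e\<close> admits a bounded solution \<open>y\<close>, with a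
  linear bound (\<open>shadowing_iff_bounded_solutions\<close>), and expansivity says exactly that bounded
  solutions are unique (\<open>expansive_iff_no_bounded_orbit\<close>).

  If solutions exist and are unique, take \<open>e n = c\<^sup>n x\<close> with \<open>c\<close> on the unit circle. Both
  \<open>y (n + 1)\<close> and \<open>c y n\<close> solve the equation for \<open>c e n\<close>, so they agree, and \<open>y 0\<close> is a preimage of
  \<open>x\<close> under \<open>c - L\<close>. Hence expansivity and shadowing give hyperbolicity.

  Asymptotic expansivity and shadowing give expansivity: a nonzero bounded two-sided orbit, faded
  out slowly in both directions and then repeated periodically, is a bounded pseudo-orbit. An orbit
  shadowing it stays bounded but returns near a fixed nonzero vector forever.

  Conversely, if the unit circle is free of spectrum, then \<open>A (1 + A\<^sup>2)\<inverse>\<close> becomes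
  arbitrarily small for the powers \<open>A = L ^^ 2 ^ j\<close> (\<open>hyperbolic_imp_small_power\<close>). Indeed \<open>G c = c (A - c)\<inverse>\<close> is Lipschitz on
  the circle, the corresponding function of \<open>A\<^sup>2\<close> at \<open>c\<^sup>2\<close> is the average of \<open>G c\<close> and \<open>G (- c)\<close>, and taking square roots contracts
  distances by the factor \<open>1 / sqrt 2\<close> when the roots are chosen well. So the Lipschitz constants
  decrease geometrically along repeated squaring, and \<open>A (1 + A\<^sup>2)\<inverse>\<close> is, up to a factor, the
  difference of \<open>G\<close> at \<open>\<i>\<close> and \<open>- \<i>\<close>.

  Once this operator has norm at most \<open>1 / 4\<close>, each term of an orbit sampled in steps of \<open>A\<close> is at
  most half the larger of its two neighbours, so bounded forward orbits decay. With \<open>S\<close> the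
  shift by the exponent of \<open>A\<close>, the factorisation
  \<open>(S - A) (S\<inverse> - A) = (1 + A\<^sup>2) (1 - A (1 + A\<^sup>2)\<inverse> (S + S\<inverse>))\<close>
  has a second factor invertible on bounded sequences, which produces the bounded solutions.
\<close>

section \<open>Complex scalars and invertible operators\<close>

lemma scaleC_zero_right: "a *\<^sub>C (0::'a::complex_normed_vector) = 0"
  using norm_scaleC[of a "0::'a"] by simp

lemma scaleC_zero_left: "0 *\<^sub>C (x::'a::complex_normed_vector) = 0"
  using norm_scaleC[of 0 x] by simp

lemma scaleC_minus_right: "a *\<^sub>C (- x) = - (a *\<^sub>C (x::'a::complex_normed_vector))"
  using scaleC_add_right[of a x "- x"] by (simp add: scaleC_zero_right eq_neg_iff_add_eq_0 add.commute)

lemma scaleC_minus_left: "(- a) *\<^sub>C x = - (a *\<^sub>C (x::'a::complex_normed_vector))"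
  using scaleC_add_left[of a "- a" x] by (simp add: scaleC_zero_left eq_neg_iff_add_eq_0 add.commute)

lemma scaleC_diff_right: "a *\<^sub>C (x - y) = a *\<^sub>C x - a *\<^sub>C (y::'a::complex_normed_vector)"
  using scaleC_add_right[of a x "- y"] by (simp add: scaleC_minus_right)

lemma scaleC_diff_left: "(a - b) *\<^sub>C x = a *\<^sub>C x - b *\<^sub>C (x::'a::complex_normed_vector)"
  using scaleC_add_left[of a "- b" x] by (simp add: scaleC_minus_left)

lemmas scaleC_simps = scaleC_add_right scaleC_add_left scaleC_diff_right scaleC_diff_left
  scaleC_minus_right scaleC_minus_left scaleC_scaleC scaleC_one scaleC_zero_right scaleC_zero_left

lemma bounded_clinear_linear: "bounded_clinear f \<Longrightarrow> bounded_linear f"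
  by (simp add: bounded_clinear_def)

lemma bounded_clinear_simps:
  assumes "bounded_clinear f"
  shows "f (x + y) = f x + f y" "f (x - y) = f x - f y" "f (- x) = - f x" "f 0 = 0"
    "f (c *\<^sub>C x) = c *\<^sub>C f x"
  using assms by (auto simp: bounded_clinear_def linear_simps)

lemma bounded_clinear_bound:
  assumes "bounded_clinear f"
  obtains K where "K > 0" "\<And>x. norm (f x) \<le> K * norm x"
  using bounded_linear.pos_bounded[OF bounded_clinear_linear[OF assms]]
  by (metis mult.commute)

lemma bounded_clinear_scaleC: "bounded_clinear ((*\<^sub>C) c :: 'a::complex_normed_vector \<Rightarrow> 'a)"
proof -
  have "bounded_linear ((*\<^sub>C) c :: 'a \<Rightarrow> 'a)"
    by (rule bounded_linear_intro[where K = "cmod c"])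
      (simp_all add: scaleC_simps scaleR_scaleC norm_scaleC mult.commute)
  then show ?thesis
    by (simp add: bounded_clinear_def scaleC_simps mult.commute)
qed

lemma bounded_clinear_compose:
  "bounded_clinear f \<Longrightarrow> bounded_clinear g \<Longrightarrow> bounded_clinear (\<lambda>x. f (g x))"
  unfolding bounded_clinear_def using bounded_linear_compose by auto

lemma bounded_clinear_diff:
  "bounded_clinear f \<Longrightarrow> bounded_clinear g \<Longrightarrow> bounded_clinear (\<lambda>x. f x - g x)"
  unfolding bounded_clinear_def using bounded_linear_sub by (auto simp: scaleC_simps)

lemma GL_bij: "L \<in> GL \<Longrightarrow> bij L"
  by (simp add: GL_def)

lemma GL_clinear: "L \<in> GL \<Longrightarrow> bounded_clinear L"
  by (simp add: GL_def)

lemma GL_I: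
  assumes f: "bounded_clinear f"
    and inj: "\<And>x. f x = 0 \<Longrightarrow> x = 0"
    and surj: "\<And>x. \<exists>y. f y = x \<and> norm y \<le> C * norm x"
  shows "f \<in> GL"
proof -
  note fs = bounded_clinear_simps[OF f]
  have i: "inj f"
    using inj fs(2) by (metis (no_types, lifting) eq_iff_diff_eq_0 injI)
  moreover have s: "surj f"
    using surj by (metis surjI)
  ultimately have b: "bij f"
    by (simp add: bij_def)
  have fi: "f (inv f x) = x" for x
    using s by (simp add: surj_f_inv_f)
  have inf: "inv f (f x) = x" for x
    using i by simp
  have n: "norm (inv f x) \<le> norm x * C" for x
    using surj[of x] inf by (metis mult.commute)
  have a: "inv f (x + y) = inv f x + inv f y" for x y
    by (metis fi fs(1) inf)
  have c: "inv f (c *\<^sub>C x) = c *\<^sub>C inv f x" for c x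
    by (metis fi fs(5) inf)
  have "bounded_linear (inv f)"
    by (rule bounded_linear_intro[where K = C]) (simp_all add: a c n scaleR_scaleC)
  then show ?thesis
    using f b c by (simp add: GL_def bounded_clinear_def)
qed

section \<open>Two-sided orbits and the inhomogeneous equation\<close>

lemma iterate_step:
  assumes "bij L"
  shows "iterate L (n + 1) x = L (iterate L n x)"
proof (cases "n \<ge> 0")
  case True
  then have "nat (n + 1) = Suc (nat n)" by simp
  with True show ?thesis by (simp add: iterate_def)
next
  case False
  define m where "m = nat (- n) - 1"
  with False have m: "nat (- n) = Suc m" "n = - int m - 1" by auto
  have "L (inv L y) = y" for y
    using assms by (simp add: bij_def surj_f_inv_f)
  then show ?thesis
    using m by (cases m) (auto simp: iterate_def nat_add_distrib)
qed

lemma orbit_eq_iterate: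
  fixes p :: "int \<Rightarrow> 'a"
  assumes "bij L" and p: "\<And>n. p (n + 1) = L (p n)"
  shows "p n = iterate L n (p 0)"
proof (induction n rule: int_induct[where k = 0])
  case base
  show ?case by (simp add: iterate_def)
next
  case (step1 i)
  then show ?case by (simp add: p iterate_step[OF assms(1)])
next
  case (step2 i)
  have "L (p (i - 1)) = L (iterate L (i - 1) (p 0))"
    using p[of "i - 1"] iterate_step[OF assms(1), of "i - 1"] step2 by simp
  then show ?case
    using assms(1) by (simp add: bij_def inj_eq)
qed

lemma funpow_orbit:
  fixes p :: "int \<Rightarrow> 'a"
  assumes "\<And>n. p (n + 1) = L (p n)"
  shows "p (n + int k) = (L ^^ k) (p n)"
  by (induction k) (use assms[of "n + int _"] in \<open>simp_all add: algebra_simps\<close>)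

text \<open>By linearity a bounded orbit can be rescaled to fit below the expansivity constant, whatever
  its size, and the difference of two orbits is an orbit.\<close>

lemma expansive_iff_no_bounded_orbit:
  fixes L :: "'a::complex_normed_vector \<Rightarrow> 'a"
  assumes L: "L \<in> GL"
  shows "expansive L \<longleftrightarrow>
    (\<forall>p M. (\<forall>n. p (n + 1) = L (p n)) \<and> (\<forall>n::int. norm (p n) \<le> M) \<longrightarrow> p 0 = 0)"
proof
  note lin = bounded_clinear_simps[OF GL_clinear[OF L]]
  assume "expansive L"
  then obtain \<epsilon> where \<epsilon>: "\<epsilon> > 0"
    and uniq: "\<And>x y. (\<And>n. norm (iterate L n x - iterate L n y) \<le> \<epsilon>) \<Longrightarrow> x = y"
    unfolding expansive_def by blast
  show "\<forall>p M. (\<forall>n. p (n + 1) = L (p n)) \<and> (\<forall>n::int. norm (p n) \<le> M) \<longrightarrow> p 0 = 0"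
  proof (intro allI impI)
    fix p :: "int \<Rightarrow> 'a" and M
    assume "(\<forall>n. p (n + 1) = L (p n)) \<and> (\<forall>n. norm (p n) \<le> M)"
    then have p: "\<And>n. p (n + 1) = L (p n)" and M: "\<And>n. norm (p n) \<le> M" by auto
    define t where "t = \<epsilon> / (\<bar>M\<bar> + 1)"
    have t: "t > 0" using \<epsilon> by (simp add: t_def)
    define q where "q n = complex_of_real t *\<^sub>C p n" for n
    have q: "q (n + 1) = L (q n)" for n by (simp add: q_def p lin)
    have z: "iterate L n (0::'a) = 0" for n
      using orbit_eq_iterate[OF GL_bij[OF L], of "\<lambda>_. 0"] lin(4) by metis
    have "norm (iterate L n (q 0) - iterate L n 0) \<le> \<epsilon>" for n
    proof -
      have "norm (q n) \<le> t * (\<bar>M\<bar> + 1)"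
        unfolding q_def norm_scaleC using t M[of n] by (auto intro!: mult_left_mono)
      then show ?thesis
        using orbit_eq_iterate[OF GL_bij[OF L], of q n] q by (simp add: z t_def)
    qed
    then have "q 0 = 0" by (rule uniq)
    then have "norm (q 0) = 0" by simp
    then show "p 0 = 0" using t by (simp add: q_def norm_scaleC)
  qed
next
  assume R: "\<forall>p M. (\<forall>n. p (n + 1) = L (p n)) \<and> (\<forall>n::int. norm (p n) \<le> M) \<longrightarrow> p 0 = 0"
  have "x = y" if "\<forall>n. norm (iterate L n x - iterate L n y) \<le> 1" for x y
  proof -
    have "(\<lambda>n. iterate L n x - iterate L n y) 0 = 0"
      using that
      by (intro R[rule_format, where M = 1])
        (simp add: iterate_step[OF GL_bij[OF L]] bounded_clinear_simps[OF GL_clinear[OF L]])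
    then show ?thesis by (simp add: iterate_def)
  qed
  then show "expansive L" unfolding expansive_def by (intro exI[of _ 1]) auto
qed

text \<open>Starting from \<open>0\<close> at time \<open>0\<close>, the recursion is run forwards with \<open>L\<close> and backwards with its
  inverse; no bound on the solution is available in general.\<close>

lemma inhomogeneous_solution_exists:
  fixes e :: "int \<Rightarrow> 'a::ab_group_add"
  assumes "bij L"
  shows "\<exists>\<xi>. \<forall>n. \<xi> (n + 1) = L (\<xi> n) + e n"
proof -
  define f where "f = rec_nat 0 (\<lambda>m y. L y + e (int m))"
  define g where "g = rec_nat 0 (\<lambda>m y. inv L (y - e (- int m - 1)))"
  define \<xi> where "\<xi> n = (if n \<ge> 0 then f (nat n) else g (nat (- n)))" for n
  have Li: "L (inv L y) = y" for y
    using assms by (simp add: bij_def surj_f_inv_f)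
  have "\<xi> (n + 1) = L (\<xi> n) + e n" for n
  proof (cases "n \<ge> 0")
    case True
    then have "nat (n + 1) = Suc (nat n)" by simp
    with True show ?thesis by (simp add: \<xi>_def f_def)
  next
    case False
    define m where "m = nat (- n) - 1"
    with False have m: "nat (- n) = Suc m" "n = - int m - 1" by auto
    have "L (\<xi> n) + e n = g m"
      using m False by (simp add: \<xi>_def g_def Li)
    moreover have "\<xi> (n + 1) = g m"
      using m by (cases m) (auto simp: \<xi>_def f_def g_def nat_add_distrib)
    ultimately show ?thesis by simp
  qed
  then show ?thesis by blast
qed

text \<open>A pseudo-orbit is a solution of the inhomogeneous equation with a small right-hand side, and it is
  shadowed by an orbit precisely when subtracting that orbit leaves a small solution. Linearity then
  turns the dependence of \<open>\<delta>\<close> on \<open>\<epsilon>\<close> into a single constant.\<close>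

lemma shadowing_iff_bounded_solutions:
  fixes L :: "'a::complex_normed_vector \<Rightarrow> 'a"
  assumes L: "L \<in> GL"
  shows "shadowing L \<longleftrightarrow>
    (\<exists>C>0. \<forall>\<delta>>0. \<forall>e. (\<forall>n. norm (e n) \<le> \<delta>) \<longrightarrow>
      (\<exists>y. \<forall>n::int. y (n + 1) = L (y n) + e n \<and> norm (y n) \<le> C * \<delta>))"
    (is "_ \<longleftrightarrow> (\<exists>C>0. ?S C)")
proof
  note lin = bounded_clinear_simps[OF GL_clinear[OF L]]
  note step = iterate_step[OF GL_bij[OF L]]
  assume "shadowing L"
  then obtain \<eta> where \<eta>: "\<eta> > 0" and sh: "\<And>\<xi>. (\<And>n. norm (L (\<xi> n) - \<xi> (n + 1)) \<le> \<eta>) \<Longrightarrow>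
      \<exists>x. \<forall>n. norm (iterate L n x - \<xi> n) \<le> 1"
    unfolding shadowing_def by (metis zero_less_one)
  have "?S (1 / \<eta>)"
  proof (intro allI impI)
    fix \<delta> :: real and e :: "int \<Rightarrow> 'a"
    assume \<delta>: "\<delta> > 0" and e: "\<forall>n. norm (e n) \<le> \<delta>"
    obtain \<xi> where \<xi>: "\<And>n. \<xi> (n + 1) = L (\<xi> n) + complex_of_real (\<eta> / \<delta>) *\<^sub>C e n"
      using inhomogeneous_solution_exists[OF GL_bij[OF L], of "\<lambda>n. complex_of_real (\<eta> / \<delta>) *\<^sub>C e n"] by blast
    have "norm (L (\<xi> n) - \<xi> (n + 1)) \<le> \<eta>" for n
    proof -
      have "norm (L (\<xi> n) - \<xi> (n + 1)) = (\<eta> / \<delta>) * norm (e n)"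
        using \<eta> \<delta> by (simp add: \<xi> norm_scaleC norm_divide)
      also have "\<dots> \<le> (\<eta> / \<delta>) * \<delta>"
        using \<eta> \<delta> e by (intro mult_left_mono) auto
      finally show ?thesis using \<delta> by simp
    qed
    then obtain x where x: "\<And>n. norm (iterate L n x - \<xi> n) \<le> 1"
      using sh by blast
    define y where "y n = complex_of_real (\<delta> / \<eta>) *\<^sub>C (\<xi> n - iterate L n x)" for n
    have "y (n + 1) = L (y n) + e n" for n
    proof -
      have "complex_of_real (\<delta> / \<eta>) * complex_of_real (\<eta> / \<delta>) = 1"
        using \<eta> \<delta> by simp
      then show ?thesis
        unfolding y_def \<xi> step lin scaleC_diff_right scaleC_add_right scaleC_scaleC
        by (simp add: scaleC_one)
    qed
    moreover have "norm (y n) \<le> 1 / \<eta> * \<delta>" for n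
    proof -
      have "norm (y n) = (\<delta> / \<eta>) * norm (iterate L n x - \<xi> n)"
        using \<eta> \<delta> by (simp add: y_def norm_scaleC norm_divide norm_minus_commute)
      also have "\<dots> \<le> (\<delta> / \<eta>) * 1"
        using \<eta> \<delta> x by (intro mult_left_mono) auto
      finally show ?thesis by simp
    qed
    ultimately show "\<exists>y. \<forall>n. y (n + 1) = L (y n) + e n \<and> norm (y n) \<le> 1 / \<eta> * \<delta>"
      by blast
  qed
  with \<eta> show "\<exists>C>0. ?S C" by (intro exI[of _ "1 / \<eta>"]) simp
next
  note lin = bounded_clinear_simps[OF GL_clinear[OF L]]
  assume "\<exists>C>0. ?S C"
  then obtain C where C: "C > 0" and S: "?S C" by blast
  show "shadowing L"
    unfolding shadowing_def
  proof (intro allI impI)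
    fix \<epsilon> :: real
    assume \<epsilon>: "\<epsilon> > 0"
    have "\<exists>x. \<forall>n. norm (iterate L n x - \<xi> n) \<le> \<epsilon>"
      if \<xi>: "\<forall>n. norm (L (\<xi> n) - \<xi> (n + 1)) \<le> \<epsilon> / C" for \<xi> :: "int \<Rightarrow> 'a"
    proof -
      have "\<exists>y. \<forall>n. y (n + 1) = L (y n) + (\<xi> (n + 1) - L (\<xi> n)) \<and> norm (y n) \<le> C * (\<epsilon> / C)"
        using S[rule_format, of "\<epsilon> / C" "\<lambda>n. \<xi> (n + 1) - L (\<xi> n)"] \<xi> \<epsilon> C
        by (simp add: norm_minus_commute)
      then obtain y
        where y: "\<And>n. y (n + 1) = L (y n) + (\<xi> (n + 1) - L (\<xi> n))"
          and b: "\<And>n. norm (y n) \<le> \<epsilon>"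
        using C by auto
      have "\<xi> (n + 1) - y (n + 1) = L (\<xi> n - y n)" for n
        by (simp add: y lin)
      then have "\<xi> n - y n = iterate L n (\<xi> 0 - y 0)" for n
        by (rule orbit_eq_iterate[OF GL_bij[OF L]])
      then have "norm (iterate L n (\<xi> 0 - y 0) - \<xi> n) = norm (y n)" for n
        by (metis diff_diff_eq2 add_diff_cancel_left' norm_minus_commute)
      with b show ?thesis by metis
    qed
    with \<epsilon> C show "\<exists>\<delta>>0. \<forall>\<xi>. (\<forall>n. norm (L (\<xi> n) - \<xi> (n + 1)) \<le> \<delta>) \<longrightarrow>
      (\<exists>x. \<forall>n. norm (iterate L n x - \<xi> n) \<le> \<epsilon>)"
      by (intro exI[of _ "\<epsilon> / C"]) auto
  qed
qed

section \<open>Expansivity and shadowing imply hyperbolicity\<close>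

text \<open>Uniqueness makes the bounded solution for \<open>e n = - c\<^sup>n x\<close> inherit the symmetry
  \<open>e (n + 1) = c e n\<close>, so its value at \<open>0\<close> solves the resolvent equation at \<open>c\<close>. An eigenvector for \<open>c\<close>
  would have a bounded orbit, so \<open>L - c\<close> is also injective.\<close>

lemma expansive_shadowing_imp_hyperbolic:
  fixes L :: "'a::complex_normed_vector \<Rightarrow> 'a"
  assumes L: "L \<in> GL" and "expansive L" "shadowing L"
  shows "hyperbolic L"
proof -
  note lin = bounded_clinear_simps[OF GL_clinear[OF L]]
  have uniq: "p 0 = 0" if "\<And>n. p (n + 1) = L (p n)" "\<And>n. norm (p n) \<le> M" for p :: "int \<Rightarrow> 'a" and M
    using assms(2) that unfolding expansive_iff_no_bounded_orbit[OF L] by blast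
  obtain C where "\<forall>\<delta>>0. \<forall>e. (\<forall>n. norm (e n) \<le> \<delta>) \<longrightarrow>
      (\<exists>y. \<forall>n::int. y (n + 1) = L (y n) + e n \<and> norm (y n) \<le> C * \<delta>)"
    using assms(3) unfolding shadowing_iff_bounded_solutions[OF L] by (elim exE conjE)
  note C = this[rule_format]
  have "(\<lambda>x. L x - c *\<^sub>C x) \<in> GL" if c: "cmod c = 1" for c
  proof (rule GL_I[where C = C])
    have c0: "c \<noteq> 0" using c by auto
    have cp: "c powi (n + 1) = c * c powi n" for n
      using c0 by (simp add: power_int_add)
    have cn: "cmod (c powi n) = 1" for n
      using c by (simp add: norm_power_int)
    show "bounded_clinear (\<lambda>x. L x - c *\<^sub>C x)"
      by (intro bounded_clinear_diff GL_clinear L bounded_clinear_scaleC)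
    show "x = 0" if "L x - c *\<^sub>C x = 0" for x
    proof -
      have "c powi 0 *\<^sub>C x = 0"
        using that cn
        by (intro uniq[where p = "\<lambda>n. c powi n *\<^sub>C x" and M = "norm x"])
          (simp_all add: lin cp norm_scaleC scaleC_simps mult.commute)
      then show ?thesis by (simp add: scaleC_simps)
    qed
    show "\<exists>y. L y - c *\<^sub>C y = x \<and> norm y \<le> C * norm x" for x
    proof (cases "x = 0")
      case True
      then show ?thesis by (intro exI[of _ 0]) (simp add: lin scaleC_simps)
    next
      case False
      have "\<exists>y. \<forall>n. y (n + 1) = L (y n) + c powi n *\<^sub>C (- x) \<and> norm (y n) \<le> C * norm x"
        using False cn by (intro C) (simp_all add: norm_scaleC)
      then obtain y where y: "\<And>n. y (n + 1) = L (y n) + c powi n *\<^sub>C (- x)"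
        and b: "\<And>n. norm (y n) \<le> C * norm x" by blast
      have "(\<lambda>n. y (n + 1) - c *\<^sub>C y n) 0 = 0"
      proof (rule uniq[where M = "2 * (C * norm x)"])
        fix n
        show "y (n + 1 + 1) - c *\<^sub>C y (n + 1) = L (y (n + 1) - c *\<^sub>C y n)"
          unfolding y[of "n + 1"] by (simp add: y[of n] cp lin scaleC_simps)
        have "norm (y (n + 1) - c *\<^sub>C y n) \<le> norm (y (n + 1)) + norm (y n)"
          using norm_triangle_ineq4[of "y (n + 1)" "c *\<^sub>C y n"] c by (simp add: norm_scaleC)
        then show "norm (y (n + 1) - c *\<^sub>C y n) \<le> 2 * (C * norm x)"
          using b[of n] b[of "n + 1"] by linarith
      qed
      then have "L (y 0) - c *\<^sub>C y 0 = x"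
        using y[of 0] by (simp add: scaleC_simps algebra_simps)
      then show ?thesis using b by blast
    qed
  qed
  then show ?thesis
    by (auto simp: hyperbolic_def spectrum_def)
qed

text \<open>Cutting a bounded orbit \<open>p\<close> off with a tent of slope \<open>1 / N\<close> and repeating the result with period
  \<open>2 N\<close> costs only an error of order \<open>1 / N\<close>. The shadowing orbit is bounded and comes back
  near \<open>p 0\<close> after every period, which asymptotic expansivity forbids unless \<open>p 0 = 0\<close>.\<close>

lemma asymptotically_expansive_shadowing_imp_expansive:
  fixes L :: "'a::complex_normed_vector \<Rightarrow> 'a"
  assumes L: "L \<in> GL" and "asymptotically_expansive L" "shadowing L"
  shows "expansive L"
proof (rule ccontr)
  note lin = bounded_clinear_simps[OF GL_clinear[OF L]]
  note step = iterate_step[OF GL_bij[OF L]]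
  assume "\<not> expansive L"
  then obtain p M where p: "\<And>n. p (n + 1) = L (p n)" and M: "\<And>n::int. norm (p n) \<le> M"
    and p0: "p 0 \<noteq> 0"
    unfolding expansive_iff_no_bounded_orbit[OF L] by blast
  have "M > 0" using M[of 0] p0 by (metis norm_le_zero_iff not_le order.trans)
  obtain \<epsilon> where \<epsilon>: "\<epsilon> > 0"
    and ae: "\<And>x. (\<And>n. norm ((L ^^ n) x) \<le> \<epsilon>) \<Longrightarrow> (\<lambda>n. (L ^^ n) x) \<longlonglongrightarrow> 0"
    using assms(2) unfolding asymptotically_expansive_def by blast
  define \<eta> where "\<eta> = norm (p 0) / 2"
  have \<eta>: "\<eta> > 0" using p0 by (simp add: \<eta>_def)
  obtain \<delta> where \<delta>: "\<delta> > 0" and sh: "\<And>\<xi>. (\<And>n. norm (L (\<xi> n) - \<xi> (n + 1)) \<le> \<delta>) \<Longrightarrow>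
      \<exists>x. \<forall>n. norm (iterate L n x - \<xi> n) \<le> \<eta>"
    using assms(3) \<eta> unfolding shadowing_def by blast
  obtain N :: nat where N: "real N > M / \<delta>"
    using reals_Archimedean2 by blast
  have N0: "real N > 0" using N \<open>M > 0\<close> \<delta> by (meson divide_pos_pos less_trans)
  have MN: "M / real N \<le> \<delta>"
    using N N0 \<delta> by (simp add: field_simps)
  \<comment> \<open>the tent \<open>a\<close>, the representative \<open>\<rho> n\<close> of \<open>n\<close> in \<open>[- N, N)\<close>, and the periodic pseudo-orbit \<open>\<xi>\<close>\<close>
  define a where "a r = 1 - \<bar>real_of_int r\<bar> / real N" for r
  define \<rho> where "\<rho> n = (n + int N) mod (2 * int N) - int N" for n
  define \<xi> where "\<xi> n = complex_of_real (a (\<rho> n)) *\<^sub>C p (\<rho> n)" for n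
  have aN: "a (int N) = 0" "a (- int N) = 0" using N0 by (simp_all add: a_def)
  have a_step: "\<bar>a r - a (r + 1)\<bar> \<le> 1 / real N" for r
  proof -
    have "a r - a (r + 1) = (\<bar>real_of_int (r + 1)\<bar> - \<bar>real_of_int r\<bar>) / real N"
      by (simp add: a_def diff_divide_distrib)
    moreover have "\<bar>\<bar>real_of_int (r + 1)\<bar> - \<bar>real_of_int r\<bar>\<bar> \<le> 1" by linarith
    ultimately show ?thesis using N0 by (simp add: divide_right_mono)
  qed
  have \<rho>_range: "- int N \<le> \<rho> n" "\<rho> n < int N" for n
    using N0 pos_mod_sign[of "2 * int N" "n + int N"] pos_mod_bound[of "2 * int N" "n + int N"]
    unfolding \<rho>_def by linarith+
  have \<rho>_step: "\<rho> (n + 1) = \<rho> n + 1 \<or> (\<rho> n + 1 = int N \<and> \<rho> (n + 1) = - int N)" for n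
  proof -
    have "(n + 1 + int N) mod (2 * int N) =
        (if (n + int N) mod (2 * int N) = 2 * int N - 1 then 0 else 1 + (n + int N) mod (2 * int N))"
    proof -
      define q where "q = 2 * int N"
      have "q > 0" using N0 by (simp add: q_def)
      moreover have "(n + 1 + int N) mod q = ((n + int N) mod q + 1) mod q"
        by (simp add: mod_simps algebra_simps)
      moreover have "0 \<le> (n + int N) mod q" "(n + int N) mod q < q"
        using \<open>q > 0\<close> by simp_all
      ultimately show ?thesis unfolding q_def[symmetric] by auto
    qed
    then show ?thesis unfolding \<rho>_def by (auto split: if_splits)
  qed
  \<comment> \<open>at the end of a period this still holds, because the tent vanishes at both \<open>N\<close> and \<open>- N\<close>\<close>
  have "\<xi> (n + 1) = complex_of_real (a (\<rho> n + 1)) *\<^sub>C p (\<rho> n + 1)" for n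
    using \<rho>_step[of n] by (auto simp: \<xi>_def aN scaleC_simps)
  then have "L (\<xi> n) - \<xi> (n + 1) = complex_of_real (a (\<rho> n) - a (\<rho> n + 1)) *\<^sub>C p (\<rho> n + 1)" for n
    by (simp add: \<xi>_def lin p scaleC_simps)
  moreover have "norm (complex_of_real (a r - a (r + 1)) *\<^sub>C p (r + 1)) \<le> \<delta>" for r
  proof -
    have "norm (complex_of_real (a r - a (r + 1)) *\<^sub>C p (r + 1)) = \<bar>a r - a (r + 1)\<bar> * norm (p (r + 1))"
      unfolding norm_scaleC norm_of_real by simp
    also have "\<dots> \<le> (1 / real N) * M"
      using a_step[of r] M[of "r + 1"] N0 by (intro mult_mono) auto
    finally show ?thesis using MN by simp
  qed
  ultimately obtain x where x: "\<And>n. norm (iterate L n x - \<xi> n) \<le> \<eta>"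
    using sh by metis
  have \<xi>_bound: "norm (\<xi> n) \<le> M" for n
  proof -
    have "\<bar>a (\<rho> n)\<bar> \<le> 1"
      using \<rho>_range[of n] N0 by (simp add: a_def abs_if field_simps)
    then have "norm (\<xi> n) \<le> 1 * M"
      unfolding \<xi>_def norm_scaleC norm_of_real using M by (intro mult_mono) auto
    then show ?thesis by simp
  qed
  \<comment> \<open>rescaling brings the shadowing orbit below the constant of asymptotic expansivity\<close>
  define t where "t = \<epsilon> / (M + \<eta>)"
  have t: "t > 0" using \<epsilon> \<eta> \<open>M > 0\<close> by (simp add: t_def)
  define q where "q n = complex_of_real t *\<^sub>C iterate L n x" for n
  have q: "q (n + 1) = L (q n)" for n by (simp add: q_def step lin)
  have qn: "q (int n) = (L ^^ n) (q 0)" for n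
    using funpow_orbit[of q L 0 n] q by simp
  have "norm (q n) \<le> \<epsilon>" for n
  proof -
    have "norm (iterate L n x) \<le> M + \<eta>"
      using x[of n] \<xi>_bound[of n] norm_triangle_sub[of "iterate L n x" "\<xi> n"] by linarith
    then have "norm (q n) \<le> t * (M + \<eta>)"
      unfolding q_def norm_scaleC using t by (auto intro!: mult_left_mono)
    then show ?thesis using \<eta> \<open>M > 0\<close> by (simp add: t_def)
  qed
  then have "(\<lambda>n. q (int n)) \<longlonglongrightarrow> 0"
    unfolding qn using ae[of "q 0"] qn by metis
  then obtain m where m: "\<And>n. n \<ge> m \<Longrightarrow> norm (q (int n)) < t * \<eta>"
    using LIMSEQ_D[of "\<lambda>n. q (int n)" 0 "t * \<eta>"] t \<eta> by auto
  define n where "n = 2 * N * m"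
  have "n \<ge> m" using N0 by (simp add: n_def)
  have "(int N + (2 * int N) * int m) mod (2 * int N) = int N"
    using N0 unfolding mod_mult_self2 by simp
  then have "(int n + int N) mod (2 * int N) = int N"
    by (simp add: n_def algebra_simps)
  then have "\<xi> (int n) = p 0" by (simp add: \<xi>_def \<rho>_def a_def scaleC_simps)
  then have "norm (iterate L (int n) x) \<ge> \<eta>"
    using x[of "int n"] norm_triangle_sub[of "p 0" "iterate L (int n) x"]
    by (simp add: norm_minus_commute \<eta>_def)
  then have "norm (q (int n)) \<ge> t * \<eta>"
    using t by (simp add: q_def norm_scaleC)
  with m[OF \<open>n \<ge> m\<close>] show False by simp
qed

section \<open>Resolvents of iterated squares on the unit circle\<close>

definition resolvent_at :: "('a::complex_normed_vector \<Rightarrow> 'a) \<Rightarrow> complex \<Rightarrow> ('a \<Rightarrow> 'a) \<Rightarrow> bool"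
  where "resolvent_at A c R \<longleftrightarrow> bounded_clinear R \<and>
    (\<forall>x. A (R x) = x + c *\<^sub>C R x) \<and> (\<forall>x. R (A x - c *\<^sub>C x) = x)"

text \<open>The Lipschitz condition is put on \<open>c (A - c)\<inverse>\<close> and not on the resolvent itself, because this
  normalisation turns the partial fraction formula for \<open>A\<^sup>2\<close> into a plain average.\<close>

definition resolvent_lipschitz ::
    "('a::complex_normed_vector \<Rightarrow> 'a) \<Rightarrow> (complex \<Rightarrow> 'a \<Rightarrow> 'a) \<Rightarrow> real \<Rightarrow> bool"
  where "resolvent_lipschitz A R K \<longleftrightarrow>
    (\<forall>c. cmod c = 1 \<longrightarrow> resolvent_at A c (R c)) \<and>
    (\<forall>c d x. cmod c = 1 \<longrightarrow> cmod d = 1 \<longrightarrow>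
      norm (c *\<^sub>C R c x - d *\<^sub>C R d x) \<le> K * cmod (c - d) * norm x)"

text \<open>A bound for the resolvent at one point of the circle gives twice that bound in a neighbourhood on
  the circle, by the resolvent identity; compactness of the circle does the rest.\<close>

lemma hyperbolic_imp_resolvent_bounded:
  fixes L :: "'a::complex_normed_vector \<Rightarrow> 'a"
  assumes "hyperbolic L"
  shows "\<exists>R M. M > 0 \<and> (\<forall>c. cmod c = 1 \<longrightarrow> resolvent_at L c (R c) \<and> (\<forall>x. norm (R c x) \<le> M * norm x))"
proof -
  define R where "R c = inv (\<lambda>x. L x - c *\<^sub>C x)" for c
  have R: "resolvent_at L c (R c)" if "cmod c = 1" for c
  proof -
    have "(\<lambda>x. L x - c *\<^sub>C x) \<in> GL"
      using assms that by (auto simp: hyperbolic_def spectrum_def)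
    then have b: "bij (\<lambda>x. L x - c *\<^sub>C x)" and "bounded_clinear (R c)"
      by (auto simp: GL_def R_def)
    moreover have "L (R c x) - c *\<^sub>C R c x = x" for x
      unfolding R_def using surj_f_inv_f[OF bij_is_surj[OF b], of x] by simp
    moreover have "R c (L x - c *\<^sub>C x) = x" for x
      unfolding R_def using inv_f_f[OF bij_is_inj[OF b], of x] by simp
    ultimately show ?thesis
      by (auto simp: resolvent_at_def algebra_simps)
  qed
  have "\<exists>m>0. \<forall>x. norm (R c x) \<le> m * norm x" if "cmod c = 1" for c
    using R[OF that] bounded_clinear_bound unfolding resolvent_at_def by metis
  then obtain m where m0: "\<And>c. cmod c = 1 \<Longrightarrow> m c > 0"
    and m: "\<And>c x. cmod c = 1 \<Longrightarrow> norm (R c x) \<le> m c * norm x" by metis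
  \<comment> \<open>the radius is chosen so that the term absorbed on the left has coefficient \<open>1 / 2\<close>\<close>
  have loc: "norm (R d x) \<le> 2 * m c * norm x"
    if c: "cmod c = 1" and d: "cmod d = 1" and dc: "dist c d < 1 / (2 * m c)" for c d x
  proof -
    define y where "y = R d x"
    have "L y = x + d *\<^sub>C y"
      using R[OF d] by (simp add: resolvent_at_def y_def)
    then have "y = R c (x + (d - c) *\<^sub>C y)"
      using R[OF c] by (metis resolvent_at_def add_diff_eq scaleC_diff_left)
    then have "norm y \<le> m c * norm (x + (d - c) *\<^sub>C y)"
      using m[OF c] by metis
    also have "\<dots> \<le> m c * (norm x + cmod (d - c) * norm y)"
      using m0[OF c] norm_triangle_ineq[of x "(d - c) *\<^sub>C y"] by (simp add: norm_scaleC)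
    also have "\<dots> \<le> m c * (norm x + 1 / (2 * m c) * norm y)"
      using m0[OF c] dc by (intro mult_left_mono add_left_mono mult_right_mono)
        (auto simp: dist_norm norm_minus_commute)
    also have "\<dots> = m c * norm x + norm y / 2"
      using m0[OF c] by (simp add: algebra_simps)
    finally show ?thesis by (simp add: y_def)
  qed
  have "compact (sphere (0::complex) 1)" by simp
  then obtain F where F: "finite F" "F \<subseteq> sphere 0 1"
    "sphere (0::complex) 1 \<subseteq> (\<Union>c\<in>F. ball c (1 / (2 * m c)))"
    by (rule compactE_image[where C = "sphere 0 1" and f = "\<lambda>c. ball c (1 / (2 * m c))"])
      (use m0 in auto)
  define M where "M = (\<Sum>c\<in>F. 2 * m c) + 1"
  have M0: "M > 0"
    using F(2) m0 unfolding M_def by (intro add_nonneg_pos sum_nonneg) (auto simp: subset_iff less_imp_le)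
  have "norm (R d x) \<le> M * norm x" if d: "cmod d = 1" for d x
  proof -
    from d F(3) obtain c where c: "c \<in> F" "dist c d < 1 / (2 * m c)" by force
    with F(2) have c1: "cmod c = 1" by auto
    have "2 * m c \<le> (\<Sum>c\<in>F. 2 * m c)"
      using F m0 c(1) by (intro member_le_sum) (auto simp: subset_iff less_imp_le)
    then have "2 * m c \<le> M" by (simp add: M_def)
    then show ?thesis
      using loc[OF c1 d c(2), of x] by (meson mult_right_mono norm_ge_zero order_trans)
  qed
  with R M0 show ?thesis by blast
qed

text \<open>From the resolvent identity,
  \<open>c (L - c)\<inverse> - d (L - d)\<inverse> = (c - d) (L - c)\<inverse> + d (c - d) (L - c)\<inverse> (L - d)\<inverse>\<close>.\<close>

lemma hyperbolic_imp_resolvent_lipschitz: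
  fixes L :: "'a::complex_normed_vector \<Rightarrow> 'a"
  assumes "hyperbolic L"
  shows "\<exists>R K. K > 0 \<and> resolvent_lipschitz L R K"
proof -
  obtain R M where M0: "M > 0" and R: "\<And>c. cmod c = 1 \<Longrightarrow> resolvent_at L c (R c)"
    and M: "\<And>c x. cmod c = 1 \<Longrightarrow> norm (R c x) \<le> M * norm x"
    using hyperbolic_imp_resolvent_bounded[OF assms] by metis
  have "norm (c *\<^sub>C R c x - d *\<^sub>C R d x) \<le> (M + M * M) * cmod (c - d) * norm x"
    if c: "cmod c = 1" and d: "cmod d = 1" for c d x
  proof -
    have Rc: "bounded_clinear (R c)" using R[OF c] by (simp add: resolvent_at_def)
    note linc = bounded_clinear_simps[OF Rc]
    have "R c (L (R d x) - c *\<^sub>C R d x) = R d x"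
      using R[OF c] by (simp add: resolvent_at_def)
    moreover have "L (R d x) - c *\<^sub>C R d x = x - (c - d) *\<^sub>C R d x"
      using R[OF d] by (simp add: resolvent_at_def scaleC_simps)
    ultimately have "R c x - R d x = (c - d) *\<^sub>C R c (R d x)"
      by (metis linc(2,5) diff_diff_eq2 add_diff_cancel_left')
    moreover have "c *\<^sub>C R c x - d *\<^sub>C R d x = (c - d) *\<^sub>C R c x + d *\<^sub>C (R c x - R d x)"
      by (simp add: scaleC_diff_left scaleC_diff_right)
    ultimately have "c *\<^sub>C R c x - d *\<^sub>C R d x = (c - d) *\<^sub>C R c x + d *\<^sub>C (c - d) *\<^sub>C R c (R d x)"
      by simp
    then have "norm (c *\<^sub>C R c x - d *\<^sub>C R d x)
        \<le> cmod (c - d) * norm (R c x) + cmod (c - d) * norm (R c (R d x))"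
      using norm_triangle_ineq[of "(c - d) *\<^sub>C R c x" "d *\<^sub>C (c - d) *\<^sub>C R c (R d x)"] d
      by (simp add: norm_scaleC)
    also have "\<dots> \<le> cmod (c - d) * (M * norm x) + cmod (c - d) * (M * (M * norm x))"
    proof (intro add_mono mult_left_mono)
      have "norm (R c (R d x)) \<le> M * norm (R d x)" by (rule M[OF c])
      also have "\<dots> \<le> M * (M * norm x)" using M[OF d] M0 by (intro mult_left_mono) auto
      finally show "norm (R c (R d x)) \<le> M * (M * norm x)" .
    qed (use M[OF c] in auto)
    finally show ?thesis by (simp add: algebra_simps)
  qed
  moreover have "M + M * M > 0" using M0 by (simp add: add_pos_pos)
  ultimately show ?thesis
    using R unfolding resolvent_lipschitz_def by blast
qed

text \<open>Partial fractions: \<open>1 / (a\<^sup>2 - c\<^sup>2) = (1 / (a - c) - 1 / (a + c)) / (2 c)\<close>.\<close>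

lemma resolvent_at_square:
  assumes A: "bounded_clinear A" and c0: "c \<noteq> 0"
    and R: "resolvent_at A c R" and Q: "resolvent_at A (- c) Q"
  shows "resolvent_at (\<lambda>x. A (A x)) (c * c) (\<lambda>x. (1 / (2 * c)) *\<^sub>C (R x - Q x))"
  unfolding resolvent_at_def
proof (intro conjI allI)
  note A' = bounded_clinear_simps[OF A]
  have "bounded_clinear R" "bounded_clinear Q"
    using R Q by (auto simp: resolvent_at_def)
  then show "bounded_clinear (\<lambda>x. (1 / (2 * c)) *\<^sub>C (R x - Q x))"
    by (intro bounded_clinear_compose[OF bounded_clinear_scaleC] bounded_clinear_diff)
  fix x
  have AR: "A (R x) = x + c *\<^sub>C R x" and AQ: "A (Q x) = x - c *\<^sub>C Q x"
    using R Q by (auto simp: resolvent_at_def scaleC_simps)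
  have "A (A (R x - Q x)) = (2 * c) *\<^sub>C x + (c * c) *\<^sub>C (R x - Q x)"
    using scaleC_add_left[of c c x] by (simp add: A' AR AQ scaleC_simps)
  then show "A (A ((1 / (2 * c)) *\<^sub>C (R x - Q x))) = x + (c * c) *\<^sub>C (1 / (2 * c)) *\<^sub>C (R x - Q x)"
    using c0 by (simp add: A' scaleC_add_right scaleC_scaleC scaleC_one mult.commute)
  have "R (A (A x + c *\<^sub>C x) - c *\<^sub>C (A x + c *\<^sub>C x)) = A x + c *\<^sub>C x"
    "Q (A (A x - c *\<^sub>C x) - (- c) *\<^sub>C (A x - c *\<^sub>C x)) = A x - c *\<^sub>C x"
    using R Q unfolding resolvent_at_def by blast+
  then have "R (A (A x) - (c * c) *\<^sub>C x) = A x + c *\<^sub>C x"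
    "Q (A (A x) - (c * c) *\<^sub>C x) = A x - c *\<^sub>C x"
    by (simp_all add: A' scaleC_simps)
  then have "R (A (A x) - (c * c) *\<^sub>C x) - Q (A (A x) - (c * c) *\<^sub>C x) = (2 * c) *\<^sub>C x"
    using scaleC_add_left[of c c x] by simp
  then show "(1 / (2 * c)) *\<^sub>C (R (A (A x) - (c * c) *\<^sub>C x) - Q (A (A x) - (c * c) *\<^sub>C x)) = x"
    using c0 by (simp add: scaleC_scaleC scaleC_one)
qed

text \<open>By the parallelogram law \<open>c - d\<close> and \<open>c + d\<close> cannot both be shorter than \<open>sqrt 2\<close>; their product is
  \<open>c\<^sup>2 - d\<^sup>2\<close>, so the other one is short.\<close>

lemma unit_square_roots_close:
  assumes c: "cmod c = 1" and d: "cmod d = 1"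
  shows "\<exists>s. (s = d \<or> s = - d) \<and> cmod (c - s) \<le> cmod (c * c - d * d) / sqrt 2"
proof -
  have par: "(cmod (c - d))\<^sup>2 + (cmod (c + d))\<^sup>2 = 2 * (cmod c)\<^sup>2 + 2 * (cmod d)\<^sup>2"
    by (simp add: cmod_power2) (simp add: power2_eq_square algebra_simps)
  have prod: "cmod (c - d) * cmod (c + d) = cmod (c * c - d * d)"
    by (simp add: square_diff_square_factored mult.commute flip: norm_mult)
  have "2 \<le> (cmod (c + d))\<^sup>2 \<or> 2 \<le> (cmod (c - d))\<^sup>2"
    using par c d by auto
  then consider "sqrt 2 \<le> cmod (c + d)" | "sqrt 2 \<le> cmod (c - d)"
    using real_le_lsqrt by (auto intro: real_le_lsqrt)
  then show ?thesis
  proof cases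
    case 1
    then have "cmod (c - d) * sqrt 2 \<le> cmod (c - d) * cmod (c + d)"
      by (intro mult_left_mono) auto
    then show ?thesis unfolding prod
      by (intro exI[of _ d]) (simp add: field_simps)
  next
    case 2
    then have "cmod (c + d) * sqrt 2 \<le> cmod (c + d) * cmod (c - d)"
      by (intro mult_left_mono) auto
    then show ?thesis unfolding mult.commute[of "cmod (c + d)" "cmod (c - d)"] prod
      by (intro exI[of _ "- d"]) (simp add: field_simps)
  qed
qed

text \<open>The average \<open>(G c + G (- c)) / 2\<close> does not depend on which square root \<open>c\<close> is used, so the roots
  of two points may be matched as closely as possible. This is what gains the factor.\<close>

lemma resolvent_lipschitz_square:
  assumes A: "bounded_clinear A" and K: "K > 0" and R: "resolvent_lipschitz A R K"
  shows "\<exists>R'. resolvent_lipschitz (\<lambda>x. A (A x)) R' (K / sqrt 2)"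
proof -
  define R' where "R' u x = (1 / (2 * csqrt u)) *\<^sub>C (R (csqrt u) x - R (- csqrt u) x)" for u x
  have res: "resolvent_at A c (R c)" if "cmod c = 1" for c
    using R that by (simp add: resolvent_lipschitz_def)
  have lip: "norm (c *\<^sub>C R c x - d *\<^sub>C R d x) \<le> K * cmod (c - d) * norm x"
    if "cmod c = 1" "cmod d = 1" for c d x
    using R that by (simp add: resolvent_lipschitz_def)
  have sq: "csqrt u * csqrt u = u" for u
    by (metis power2_csqrt power2_eq_square)
  have sq1: "cmod (csqrt u) = 1" if "cmod u = 1" for u
    using that by simp
  have "resolvent_at (\<lambda>x. A (A x)) u (R' u)" if u: "cmod u = 1" for u
  proof -
    have "csqrt u \<noteq> 0" using sq1[OF u] by auto
    then show ?thesis
      using resolvent_at_square[OF A _ res[OF sq1[OF u]] res[of "- csqrt u"]] sq1[OF u]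
      unfolding sq R'_def by simp
  qed
  moreover have "norm (u *\<^sub>C R' u x - v *\<^sub>C R' v x) \<le> K / sqrt 2 * cmod (u - v) * norm x"
    if u: "cmod u = 1" and v: "cmod v = 1" for u v x
  proof -
    define G where "G c = c *\<^sub>C R c x" for c
    have G': "w *\<^sub>C R' w x = (1 / 2) *\<^sub>C (G s + G (- s))"
      if "cmod w = 1" "s = csqrt w \<or> s = - csqrt w" for w s
    proof -
      have "w * (1 / (2 * csqrt w)) = (1 / 2) * csqrt w"
      proof -
        have "r * r = w \<Longrightarrow> r \<noteq> 0 \<Longrightarrow> w * (1 / (2 * r)) = (1 / 2) * r" for r
          by auto
        moreover have "csqrt w \<noteq> 0" using sq1[OF that(1)] by auto
        ultimately show ?thesis using sq by blast
      qed
      then have "w *\<^sub>C R' w x = ((1 / 2) * csqrt w) *\<^sub>C (R (csqrt w) x - R (- csqrt w) x)"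
        by (simp only: R'_def scaleC_scaleC)
      then show ?thesis
        using that(2) by (auto simp: G_def scaleC_simps)
    qed
    obtain s where s: "s = csqrt v \<or> s = - csqrt v"
      and close: "cmod (csqrt u - s) \<le> cmod (u - v) / sqrt 2"
      using unit_square_roots_close[OF sq1[OF u] sq1[OF v]] unfolding sq by blast
    have s1: "cmod s = 1" using s sq1[OF v] by auto
    define c where "c = csqrt u"
    have c1: "cmod c = 1" using sq1[OF u] by (simp add: c_def)
    have "u *\<^sub>C R' u x - v *\<^sub>C R' v x = (1 / 2) *\<^sub>C ((G c - G s) + (G (- c) - G (- s)))"
      using G'[OF u, of c] G'[OF v s] by (simp add: c_def scaleC_simps)
    then have "norm (u *\<^sub>C R' u x - v *\<^sub>C R' v x) \<le> (norm (G c - G s) + norm (G (- c) - G (- s))) / 2"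
      using norm_triangle_ineq[of "G c - G s" "G (- c) - G (- s)"] by (simp add: norm_scaleC)
    also have "\<dots> \<le> (K * cmod (c - s) * norm x + K * cmod (- c - - s) * norm x) / 2"
      unfolding G_def using c1 s1 by (intro divide_right_mono add_mono lip) auto
    also have "\<dots> = K * cmod (c - s) * norm x"
      by (simp add: norm_minus_commute)
    also have "\<dots> \<le> K * (cmod (u - v) / sqrt 2) * norm x"
      using close K by (intro mult_right_mono mult_left_mono) (auto simp: c_def)
    finally show ?thesis by simp
  qed
  ultimately show ?thesis unfolding resolvent_lipschitz_def by blast
qed

lemma bounded_clinear_funpow:
  fixes L :: "'a::complex_normed_vector \<Rightarrow> 'a"
  assumes "bounded_clinear L"
  shows "bounded_clinear (L ^^ k)"
proof (induction k)
  case 0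
  have "L ^^ 0 = (\<lambda>x. x)" by (simp add: fun_eq_iff)
  then show ?case unfolding bounded_clinear_def by (simp only: bounded_linear_ident) simp
next
  case (Suc k)
  then show ?case using bounded_clinear_compose[OF assms Suc] by (simp add: comp_def)
qed

lemma resolvent_lipschitz_funpow:
  assumes L: "bounded_clinear L" and K: "K > 0" and R: "resolvent_lipschitz L R K"
  shows "\<exists>R'. resolvent_lipschitz (L ^^ (2 ^ j)) R' (K / sqrt 2 ^ j)"
proof (induction j)
  case 0
  then show ?case using R by auto
next
  case (Suc j)
  then obtain R' where R': "resolvent_lipschitz (L ^^ (2 ^ j)) R' (K / sqrt 2 ^ j)" by blast
  have "(\<lambda>x. (L ^^ (2 ^ j)) ((L ^^ (2 ^ j)) x)) = L ^^ (2 ^ Suc j)"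
    by (simp add: fun_eq_iff funpow_add mult_2)
  then show ?case
    using resolvent_lipschitz_square[OF bounded_clinear_funpow[OF L] _ R'] K by (simp add: mult.commute)
qed

text \<open>With \<open>A = L ^^ k\<close>, the operator \<open>D\<close> is \<open>(1 + A\<^sup>2)\<inverse>\<close>, the resolvent of \<open>A\<^sup>2\<close> at \<open>- 1\<close>. Partial
  fractions give \<open>2 A D = (A - \<i>)\<inverse> + (A + \<i>)\<inverse>\<close>, which has the norm of \<open>G \<i> - G (- \<i>)\<close> and is therefore
  controlled by the Lipschitz constant. The value \<open>1 / 4\<close> is what makes \<open>A D\<close> applied to a sum of two
  terms a contraction by \<open>1 / 2\<close>.\<close>

lemma hyperbolic_imp_small_power:
  fixes L :: "'a::complex_normed_vector \<Rightarrow> 'a"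
  assumes L: "L \<in> GL" and "hyperbolic L"
  obtains k D where "bounded_clinear D"
    "\<And>x. D x + (L ^^ k) ((L ^^ k) (D x)) = x" "\<And>x. D (x + (L ^^ k) ((L ^^ k) x)) = x"
    "\<And>x. norm ((L ^^ k) (D x)) \<le> norm x / 4"
proof -
  obtain R K where K: "K > 0" and R: "resolvent_lipschitz L R K"
    using hyperbolic_imp_resolvent_lipschitz[OF assms(2)] by blast
  obtain j where j: "4 * K < sqrt 2 ^ j"
    using real_arch_pow[of "sqrt 2" "4 * K"] by auto
  define k :: nat where "k = 2 ^ j"
  define A where "A = L ^^ k"
  have A: "bounded_clinear A"
    unfolding A_def by (rule bounded_clinear_funpow[OF GL_clinear[OF L]])
  note A' = bounded_clinear_simps[OF A]
  obtain Q where Q: "resolvent_lipschitz A Q (K / sqrt 2 ^ j)"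
    using resolvent_lipschitz_funpow[OF GL_clinear[OF L] K R] unfolding A_def k_def by blast
  have Qp: "resolvent_at A \<i> (Q \<i>)" and Qm: "resolvent_at A (- \<i>) (Q (- \<i>))"
    using Q by (auto simp: resolvent_lipschitz_def)
  define D where "D x = (1 / (2 * \<i>)) *\<^sub>C (Q \<i> x - Q (- \<i>) x)" for x
  have D: "resolvent_at (\<lambda>x. A (A x)) (- 1) D"
    using resolvent_at_square[OF A _ Qp Qm] by (simp add: D_def[abs_def])
  show thesis
  proof (rule that[of D k])
    show "bounded_clinear D" using D by (simp add: resolvent_at_def)
    fix x
    show "D x + (L ^^ k) ((L ^^ k) (D x)) = x"
      using D by (simp add: resolvent_at_def scaleC_simps flip: A_def)
    show "D (x + (L ^^ k) ((L ^^ k) x)) = x"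
      using D by (simp add: resolvent_at_def scaleC_simps add.commute flip: A_def)
    have "A (Q \<i> x - Q (- \<i>) x) = \<i> *\<^sub>C Q \<i> x - (- \<i>) *\<^sub>C Q (- \<i>) x"
      using Qp Qm by (simp add: resolvent_at_def A')
    then have "norm (A (D x)) = norm (\<i> *\<^sub>C Q \<i> x - (- \<i>) *\<^sub>C Q (- \<i>) x) / 2"
      by (simp add: D_def A' norm_scaleC norm_divide norm_mult)
    also have "\<dots> \<le> (K / sqrt 2 ^ j * cmod (\<i> - (- \<i>)) * norm x) / 2"
    proof (intro divide_right_mono)
      have "cmod \<i> = 1" "cmod (- \<i>) = 1" by simp_all
      then show "norm (\<i> *\<^sub>C Q \<i> x - (- \<i>) *\<^sub>C Q (- \<i>) x) \<le> K / sqrt 2 ^ j * cmod (\<i> - (- \<i>)) * norm x"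
        using Q unfolding resolvent_lipschitz_def by blast
    qed simp
    also have "\<dots> = K / sqrt 2 ^ j * norm x"
      by (simp add: norm_mult)
    also have "\<dots> \<le> (1 / 4) * norm x"
      using j K by (intro mult_right_mono) (auto simp: field_simps)
    finally show "norm ((L ^^ k) (D x)) \<le> norm x / 4" by (simp add: A_def)
  qed
qed

section \<open>Consequences of hyperbolicity\<close>

text \<open>The bound valid at all later times is halved whenever the starting time is delayed by \<open>k\<close>.\<close>

lemma bounded_mean_le_quarter_decays:
  fixes a :: "nat \<Rightarrow> real"
  assumes b: "\<And>n. a n \<le> M" and h: "\<And>n. a (n + k) \<le> (a n + a (n + 2 * k)) / 4"
  shows "n \<ge> j * k \<Longrightarrow> a n \<le> M / 2 ^ j"
proof (induction j arbitrary: n)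
  case 0
  then show ?case using b by simp
next
  case (Suc j)
  then obtain m where m: "n = m + k" "m \<ge> j * k"
    by (metis add.commute add_le_cancel_left le_Suc_ex mult_Suc add.assoc le_add1)
  have "a n \<le> (a m + a (m + 2 * k)) / 4" using h m by simp
  also have "\<dots> \<le> (M / 2 ^ j + M / 2 ^ j) / 4"
    using Suc.IH[of m] Suc.IH[of "m + 2 * k"] m by (intro divide_right_mono add_mono) auto
  finally show ?case by simp
qed

text \<open>For three consecutive terms \<open>y, A y, A\<^sup>2 y\<close> with \<open>A = L ^^ k\<close>, the middle one is
  \<open>A D (y + A\<^sup>2 y)\<close>.\<close>

lemma orbit_mean_quarter:
  fixes L :: "'a::complex_normed_vector \<Rightarrow> 'a"
  assumes "\<And>x. D (x + (L ^^ k) ((L ^^ k) x)) = x" "\<And>x. norm ((L ^^ k) (D x)) \<le> norm x / 4"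
  shows "norm ((L ^^ (n + k)) x) \<le> (norm ((L ^^ n) x) + norm ((L ^^ (n + 2 * k)) x)) / 4"
proof -
  define y where "y = (L ^^ n) x"
  have e: "(L ^^ (n + k)) x = (L ^^ k) y" "(L ^^ (n + 2 * k)) x = (L ^^ k) ((L ^^ k) y)"
    unfolding y_def mult_2 by (simp_all only: add.commute[of n] funpow_add comp_def add.assoc)
  have "norm ((L ^^ k) y) \<le> norm (y + (L ^^ k) ((L ^^ k) y)) / 4"
    using assms by metis
  also have "\<dots> \<le> (norm y + norm ((L ^^ k) ((L ^^ k) y))) / 4"
    using norm_triangle_ineq by (intro divide_right_mono) auto
  finally show ?thesis unfolding e by (simp add: y_def)
qed

lemma hyperbolic_imp_asymptotically_expansive:
  fixes L :: "'a::complex_normed_vector \<Rightarrow> 'a"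
  assumes L: "L \<in> GL" and "hyperbolic L"
  shows "asymptotically_expansive L"
proof -
  obtain k D where D: "\<And>x. D (x + (L ^^ k) ((L ^^ k) x)) = x"
    "\<And>x. norm ((L ^^ k) (D x)) \<le> norm x / 4"
    using hyperbolic_imp_small_power[OF assms] by metis
  have "(\<lambda>n. (L ^^ n) x) \<longlonglongrightarrow> 0" if b: "\<And>n. norm ((L ^^ n) x) \<le> 1" for x
  proof (rule LIMSEQ_I)
    fix r :: real
    assume "r > 0"
    then obtain j where j: "(1 / 2) ^ j < r"
      using real_arch_pow_inv[of r "1 / 2"] by auto
    have "norm ((L ^^ n) x) < r" if "n \<ge> j * k" for n
      using bounded_mean_le_quarter_decays[of "\<lambda>n. norm ((L ^^ n) x)" 1 k j n, OF b orbit_mean_quarter[OF D] that] j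
      by (simp add: power_divide)
    then show "\<exists>m. \<forall>n\<ge>m. norm ((L ^^ n) x - 0) < r" by auto
  qed
  then show ?thesis
    unfolding asymptotically_expansive_def by (intro exI[of _ 1]) auto
qed

text \<open>The right-hand side contracts bounded sequences by the factor \<open>1 / 2\<close>, so the Neumann series
  converges.\<close>

lemma mean_equation_bounded_solution:
  fixes B :: "'a::banach \<Rightarrow> 'a" and f :: "int \<Rightarrow> 'a"
  assumes B: "bounded_linear B" and small: "\<And>x. norm (B x) \<le> norm x / 4"
    and f: "\<And>n. norm (f n) \<le> M"
  shows "\<exists>w. \<forall>n. w n = B (w (n + k) + w (n - k)) + f n \<and> norm (w n) \<le> 2 * M"
proof -
  define u where "u = rec_nat f (\<lambda>_ v n. B (v (n + k) + v (n - k)))"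
  have u0: "u 0 n = f n" and uS: "u (Suc m) n = B (u m (n + k) + u m (n - k))" for m n
    by (simp_all add: u_def)
  have bound: "norm (u m n) \<le> M * (1 / 2) ^ m" for m n
  proof (induction m arbitrary: n)
    case 0
    show ?case using f by (simp add: u0)
  next
    case (Suc m)
    have "norm (u (Suc m) n) \<le> (norm (u m (n + k)) + norm (u m (n - k))) / 4"
      unfolding uS by (rule order_trans[OF small]) (simp add: norm_triangle_ineq)
    then show ?case using Suc[of "n + k"] Suc[of "n - k"] by simp
  qed
  have geo: "(\<lambda>m. M * (1 / 2) ^ m) sums (2 * M)"
    using sums_mult[OF geometric_sums[of "1 / 2 :: real"], of M] by (simp add: mult.commute)
  have sm: "summable (\<lambda>m. u m n)" for n
    by (rule summable_comparison_test'[OF sums_summable[OF geo]]) (rule bound)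
  define w where "w n = (\<Sum>m. u m n)" for n
  have "w n = B (w (n + k) + w (n - k)) + f n" for n
  proof -
    have "B (w (n + k) + w (n - k)) = (\<Sum>m. u (Suc m) n)"
      unfolding w_def uS suminf_add[OF sm sm]
      by (rule bounded_linear.suminf[OF B summable_add[OF sm sm]])
    also have "\<dots> = w n - f n"
      using suminf_split_head[OF sm] by (simp add: w_def u0)
    finally show ?thesis by simp
  qed
  moreover have "norm (w n) \<le> 2 * M" for n
    unfolding w_def sums_unique[OF geo] by (rule norm_suminf_le[OF bound sums_summable[OF geo]])
  ultimately show ?thesis by blast
qed

text \<open>With the unit shift \<open>S\<close>, the operator \<open>S ^^ k - L ^^ k\<close> is \<open>S - L\<close> times a sum of products of powers
  of \<open>S\<close> and \<open>L\<close>. Applying that sum to \<open>z\<close>, built up by Horner's rule along the induction, reduces the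
  equation for \<open>L\<close> to one for \<open>L ^^ k\<close> with time step \<open>k\<close>.\<close>

lemma solution_from_power:
  fixes L :: "'a::complex_normed_vector \<Rightarrow> 'a"
  assumes L: "bounded_clinear L"
  shows "\<exists>\<beta>\<ge>0. \<forall>z Z. (\<forall>n::int. norm (z n) \<le> Z) \<longrightarrow>
    (\<exists>y. \<forall>n. y (n + 1) = L (y n) + (z (n + int k) - (L ^^ k) (z n)) \<and> norm (y n) \<le> \<beta> * Z)"
proof (induction k)
  case 0
  show ?case
    by (intro exI[of _ 0] conjI allI impI exI[of _ "\<lambda>_. 0"]) (simp_all add: bounded_clinear_simps[OF L])
next
  case (Suc k)
  note lin = bounded_clinear_simps[OF L]
  obtain K where K: "K > 0" "\<And>x. norm (L x) \<le> K * norm x"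
    using bounded_clinear_bound[OF L] by blast
  from Suc obtain \<beta> where \<beta>: "\<beta> \<ge> 0" and IH: "\<And>z Z. (\<And>n::int. norm (z n) \<le> Z) \<Longrightarrow>
    \<exists>y. \<forall>n. y (n + 1) = L (y n) + (z (n + int k) - (L ^^ k) (z n)) \<and> norm (y n) \<le> \<beta> * Z"
    by blast
  have "\<exists>y. \<forall>n. y (n + 1) = L (y n) + (z (n + int (Suc k)) - (L ^^ Suc k) (z n))
      \<and> norm (y n) \<le> (K * \<beta> + 1) * Z"
    if z: "\<forall>n. norm (z n) \<le> Z" for z :: "int \<Rightarrow> 'a" and Z
  proof -
    obtain y where y: "\<And>n. y (n + 1) = L (y n) + (z (n + int k) - (L ^^ k) (z n))"
      and b: "\<And>n. norm (y n) \<le> \<beta> * Z" using IH z by metis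
    define y' where "y' n = L (y n) + z (n + int k)" for n
    have "norm (y' n) \<le> (K * \<beta> + 1) * Z" for n
    proof -
      have "norm (L (y n)) \<le> K * (\<beta> * Z)"
        using K(2)[of "y n"] mult_left_mono[OF b[of n], of K] K(1) by linarith
      then show ?thesis
        using z[rule_format, of "n + int k"] norm_triangle_ineq[of "L (y n)" "z (n + int k)"]
        by (simp add: y'_def algebra_simps)
    qed
    moreover have "y' (n + 1) = L (y' n) + (z (n + int (Suc k)) - (L ^^ Suc k) (z n))" for n
      unfolding y'_def y by (simp add: lin algebra_simps)
    ultimately show ?thesis by blast
  qed
  then show ?case using K(1) \<beta> by (intro exI[of _ "K * \<beta> + 1"]) auto
qed

text \<open>If \<open>w\<close> solves the mean equation with right-hand side \<open>D e\<close>, multiplying it by \<open>1 + A\<^sup>2\<close> shows that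
  \<open>z n = w (n - k) - A (w n)\<close> satisfies \<open>z (n + k) - A (z n) = e n\<close>.\<close>

lemma small_power_imp_bounded_solutions:
  fixes L :: "'a::complex_banach \<Rightarrow> 'a"
  assumes L: "bounded_clinear L" and D: "bounded_clinear D"
    and inv: "\<And>x. D x + (L ^^ k) ((L ^^ k) (D x)) = x"
    and small: "\<And>x. norm ((L ^^ k) (D x)) \<le> norm x / 4"
  shows "\<exists>C>0. \<forall>\<delta>>0. \<forall>e. (\<forall>n. norm (e n) \<le> \<delta>) \<longrightarrow>
      (\<exists>y. \<forall>n::int. y (n + 1) = L (y n) + e n \<and> norm (y n) \<le> C * \<delta>)"
proof -
  define A where "A = L ^^ k"
  have A: "bounded_clinear A" unfolding A_def by (rule bounded_clinear_funpow[OF L])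
  note inv = inv[folded A_def] and small = small[folded A_def]
  note A' = bounded_clinear_simps[OF A] and D' = bounded_clinear_simps[OF D]
  obtain a where a: "a > 0" "\<And>x. norm (A x) \<le> a * norm x"
    using bounded_clinear_bound[OF A] by blast
  obtain d where d: "d > 0" "\<And>x. norm (D x) \<le> d * norm x"
    using bounded_clinear_bound[OF D] by blast
  obtain \<beta> where \<beta>: "\<beta> \<ge> 0" and power: "\<And>z Z. (\<And>n::int. norm (z n) \<le> Z) \<Longrightarrow>
    \<exists>y. \<forall>n. y (n + 1) = L (y n) + (z (n + int k) - A (z n)) \<and> norm (y n) \<le> \<beta> * Z"
    using solution_from_power[OF L, of k] unfolding A_def by blast
  define \<gamma> where "\<gamma> = (1 + a) * (2 * d)"
  have \<gamma>: "\<gamma> > 0" using a(1) d(1) by (simp add: \<gamma>_def)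
  have "\<exists>y. \<forall>n. y (n + 1) = L (y n) + e n \<and> norm (y n) \<le> (\<beta> * \<gamma> + 1) * \<delta>"
    if \<delta>: "\<delta> > 0" and e: "\<forall>n. norm (e n) \<le> \<delta>" for \<delta> and e :: "int \<Rightarrow> 'a"
  proof -
    have De: "norm (D (e n)) \<le> d * \<delta>" for n
      using d(2)[of "e n"] mult_left_mono[OF e[rule_format, of n], of d] d(1) by linarith
    have "bounded_linear (\<lambda>x. A (D x))"
      using bounded_clinear_compose[OF A D] by (simp add: bounded_clinear_def)
    from mean_equation_bounded_solution[where f = "\<lambda>n. D (e n)", OF this small De, of "int k"]
    obtain w where w: "\<And>n. w n = A (D (w (n + int k) + w (n - int k))) + D (e n)"
      and wb: "\<And>n. norm (w n) \<le> 2 * (d * \<delta>)" by blast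
    define z where "z n = w (n - int k) - A (w n)" for n
    have zb: "norm (z n) \<le> \<gamma> * \<delta>" for n
    proof -
      have "norm (A (w n)) \<le> a * (2 * (d * \<delta>))"
        using a(2)[of "w n"] mult_left_mono[OF wb[of n], of a] a(1) by linarith
      then show ?thesis
        using wb[of "n - int k"] norm_triangle_ineq4[of "w (n - int k)" "A (w n)"]
        by (simp add: z_def \<gamma>_def algebra_simps)
    qed
    have ze: "z (n + int k) - A (z n) = e n" for n
    proof -
      define s where "s = w (n + int k) + w (n - int k)"
      have "w n + A (A (w n)) = A (D s + A (A (D s))) + (D (e n) + A (A (D (e n))))"
        unfolding w[of n, folded s_def] by (simp add: A' algebra_simps)
      then have "w n + A (A (w n)) = A s + e n" by (simp add: inv)
      then show ?thesis by (simp add: z_def s_def A' algebra_simps)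
    qed
    from power[of z, OF zb] obtain y where y: "\<And>n. y (n + 1) = L (y n) + e n"
      and b: "\<And>n. norm (y n) \<le> \<beta> * (\<gamma> * \<delta>)" unfolding ze by blast
    have "norm (y n) \<le> (\<beta> * \<gamma> + 1) * \<delta>" for n
      using b[of n] \<delta> by (simp add: algebra_simps)
    with y show ?thesis by blast
  qed
  then show ?thesis
    using \<beta> \<gamma> by (intro exI[of _ "\<beta> * \<gamma> + 1"]) (simp add: add_nonneg_pos)
qed

lemma hyperbolic_imp_shadowing:
  fixes L :: "'a::complex_banach \<Rightarrow> 'a"
  assumes L: "L \<in> GL" and "hyperbolic L"
  shows "shadowing L"
proof -
  obtain k D where "bounded_clinear D" "\<And>x. D x + (L ^^ k) ((L ^^ k) (D x)) = x"
    "\<And>x. norm ((L ^^ k) (D x)) \<le> norm x / 4"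
    using hyperbolic_imp_small_power[OF assms] by metis
  from small_power_imp_bounded_solutions[OF GL_clinear[OF L] this]
  show ?thesis unfolding shadowing_iff_bounded_solutions[OF L] .
qed

theorem theorem2p2:
  fixes L :: "'a::complex_banach \<Rightarrow> 'a"
  assumes "L \<in> GL"
  shows "(expansive L \<and> shadowing L \<longleftrightarrow> asymptotically_expansive L \<and> shadowing L) \<and>
         (asymptotically_expansive L \<and> shadowing L \<longleftrightarrow> hyperbolic L)"
  using expansive_shadowing_imp_hyperbolic[OF assms]
    asymptotically_expansive_shadowing_imp_expansive[OF assms]
    hyperbolic_imp_asymptotically_expansive[OF assms] hyperbolic_imp_shadowing[OF assms]
  by blast

end
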